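(* Assume the observation model, the exchangeable exponential moment condition on $\xi$ with constants $\beta\in(0,1]$, $B>0$, and the empirical Bayes construction with prior parameter $\varkappa$ described in the context, and assume $\varkappa>\bar\varkappa:=(12-\beta+4B)/(4\beta)$. Let $(\hat\pi(\vartheta|X),\hat\theta)$ be either $(\tilde\pi(\vartheta|X),\tilde\theta)$ or $(\check\pi(\vartheta|X),\check\theta)$. Then there exist positive constants $M_0,M_1,H_0,H_1,m_0,m_1$, depending only on $\beta,B,\varkappa$, such that for any $\theta\in\mathbb{R}^n$ and any $M\ge 0$, $$\text{(i)}\quad \mathrm{E}_\theta\,\hat\pi\big(\|\vartheta-\theta\|^2\ge M_0 r^2(\theta)+M\sigma^2\,\big|\,X\big)\le H_0e^{-m_0M},$$ $$\text{(ii)}\quad \mathrm{P}_\theta\big(\|\hat\theta-\theta\|^2\ge M_1r^2(\theta)+M\sigma^2\big)\le H_1e^{-m_1M}.$$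
   Context: Model. $n\in\mathbb{N}$, $[n]=\{1,\dots,n\}$, $\sigma>0$ known, $\theta\in\mathbb{R}^n$ unknown. One observes $X=(X_1,\dots,X_n)$, $X_i=\theta_i+\sigma\xi_i$, $i\in[n]$, where $\xi=(\xi_1,\dots,\xi_n)$ is a random vector (its distribution is unknown, may depend on $\theta$, and its coordinates need not be independent or normal) with $\mathrm{E}\xi_i=0$, $\mathrm{Var}(\xi_i)\le 1$. $\mathrm{P}_\theta,\mathrm{E}_\theta$ denote the law of $X$ and its expectation. $\|\cdot\|$ is the Euclidean norm. Exchangeable exponential moment condition with constants $\beta\in(0,1]$, $B>0$: $\mathrm{E}\exp\{\beta\sum_{i\in I}\xi_i^2\}\le e^{B|I|}$ for all $I\subseteq[n]$ (for every $\theta$, if the law of $\xi$ depends on $\theta$). Conventions. $\mathcal{I}$ is the family of all subsets of $[n]$ (including $\varnothing$), $I^c=[n]\setminus I$, $0\log(c/0)=0$ and $(c/0)^0=1$ for $c>0$, $\mathrm{N}(\mu,0)=\delta_\mu$ is the Dirac measure, $\phi(x,\mu,s^2)$ is the $\mathrm{N}(\mu,s^2)$ density at $x$, $X(I)=(X_i\mathbf{1}\{i\in I\})_{i\in[n]}$. Empirical Bayes construction. Fix $\varkappa>1$. Let $\lambda_I=c_{\varkappa,n}(en/|I|)^{-\varkappa|I|}$, $I\in\mathcal{I}$, with $c_{\varkappa,n}$ normalizing so that $\sum_{I}\lambda_I=1$; $K_n(I)=(\frac{en}{|I|}-1)\mathbf{1}\{I\ne\varnothing\}$; $\tau_i^2(I)=\sigma^2K_n(I)\mathbf{1}\{i\in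 I\}$; $\mathrm{P}_{X,I}=\prod_{i=1}^n\phi(X_i,X_i\mathbf{1}\{i\in I\},\sigma^2+\tau_i^2(I))$. Define - $\tilde\pi(I|X)=\lambda_I\mathrm{P}_{X,I}/\sum_{J\in\mathcal{I}}\lambda_J\mathrm{P}_{X,J}$; - $\tilde\pi_I(\vartheta|X)=\bigotimes_{i=1}^n\mathrm{N}\big(X_i\mathbf{1}\{i\in I\},\frac{K_n(I)\sigma^2\mathbf{1}\{i\in I\}}{K_n(I)+1}\big)$, a distribution for $\vartheta\in\mathbb{R}^n$; - $\tilde\pi(\vartheta|X)=\sum_{I}\tilde\pi_I(\vartheta|X)\tilde\pi(I|X)$, with mean $\tilde\theta=\sum_IX(I)\tilde\pi(I|X)$; - $\hat I$ any maximizer of $\tilde\pi(I|X)$ over $I\in\mathcal{I}$, equivalently any minimizer of $\sum_{i\in I^c}X_i^2+(2\varkappa+1)\sigma^2|I|\log(\frac{en}{|I|})$; - $\check\pi(\vartheta|X)=\tilde\pi_{\hat I}(\vartheta|X)$, with mean $\check\theta=X(\hat I)$. Oracle rate. $r^2(I,\theta)=\sum_{i\in I^c}\theta_i^2+\sigma^2|I|\log(\frac{en}{|I|})$ for $I\in\mathcal{I}$ and $r^2(\theta)=\min_{I\in\mathcal{I}}r^2(I,\theta)$. *)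

theory Defs
  imports "HOL-Probability.Probability"
begin

text \<open>Vectors of \<open>\<real>\<^sup>n\<close> are functions on the index set \<open>{1..n}\<close>, extended by \<open>undefined\<close> outside it,
  so that the dimension can be quantified within a formula. The Euclidean norm is
  \<open>L2_set _ {1..n}\<close>.\<close>

abbreviation Rn :: "nat \<Rightarrow> (nat \<Rightarrow> real) measure" where
  "Rn n \<equiv> Pi\<^sub>M {1..n} (\<lambda>_. borel)"

definition noise_law :: "nat \<Rightarrow> (nat \<Rightarrow> real) measure \<Rightarrow> bool" where
  "noise_law n P \<longleftrightarrow>
     prob_space P \<and> sets P = sets (Rn n) \<and>
     (\<forall>i\<in>{1..n}. integrable P (\<lambda>\<xi>. \<xi> i) \<and> integrable P (\<lambda>\<xi>. (\<xi> i)\<^sup>2) \<and>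
        prob_space.expectation P (\<lambda>\<xi>. \<xi> i) = 0 \<and>
        prob_space.variance P (\<lambda>\<xi>. \<xi> i) \<le> 1)"

definition exch_exp_moment :: "real \<Rightarrow> real \<Rightarrow> nat \<Rightarrow> (nat \<Rightarrow> real) measure \<Rightarrow> bool" where
  "exch_exp_moment \<beta> B n P \<longleftrightarrow>
     (\<forall>I\<subseteq>{1..n}. (\<integral>\<^sup>+ \<xi>. ennreal (exp (\<beta> * (\<Sum>i\<in>I. (\<xi> i)\<^sup>2))) \<partial>P) \<le> ennreal (exp (B * real (card I))))"

text \<open>The law of \<open>X = \<theta> + \<sigma> \<xi>\<close> when \<open>\<xi>\<close> has law \<open>P\<close>.\<close>

definition obs_law :: "nat \<Rightarrow> real \<Rightarrow> (nat \<Rightarrow> real) \<Rightarrow> (nat \<Rightarrow> real) measure \<Rightarrow> (nat \<Rightarrow> real) measure" where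
  "obs_law n \<sigma> \<theta> P = distr P (Rn n) (\<lambda>\<xi>. \<lambda>i\<in>{1..n}. \<theta> i + \<sigma> * \<xi> i)"

definition restr :: "nat \<Rightarrow> (nat \<Rightarrow> real) \<Rightarrow> nat set \<Rightarrow> nat \<Rightarrow> real" where
  "restr n X I = (\<lambda>i\<in>{1..n}. X i * indicator I i)"

text \<open>The second argument is the variance; variance \<open>0\<close> gives the Dirac measure.\<close>

definition normal_law :: "real \<Rightarrow> real \<Rightarrow> real measure" where
  "normal_law \<mu> v = (if v = 0 then return borel \<mu> else density lborel (normal_density \<mu> (sqrt v)))"

text \<open>The empty set is treated separately because of the convention \<open>(c/0)\<^sup>0 = 1\<close>,
  whereas \<open>0 powr 0 = 0\<close>.\<close>

definition prior_unnorm :: "real \<Rightarrow> nat \<Rightarrow> nat set \<Rightarrow> real" where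
  "prior_unnorm \<kappa> n I =
     (if I = {} then 1 else (exp 1 * real n / real (card I)) powr (- \<kappa> * real (card I)))"

definition prior_weight :: "real \<Rightarrow> nat \<Rightarrow> nat set \<Rightarrow> real" where
  "prior_weight \<kappa> n I = prior_unnorm \<kappa> n I / (\<Sum>J\<in>Pow {1..n}. prior_unnorm \<kappa> n J)"

definition K_factor :: "nat \<Rightarrow> nat set \<Rightarrow> real" where
  "K_factor n I = (if I = {} then 0 else exp 1 * real n / real (card I) - 1)"

definition tau_sq :: "nat \<Rightarrow> real \<Rightarrow> nat set \<Rightarrow> nat \<Rightarrow> real" where
  "tau_sq n \<sigma> I i = \<sigma>\<^sup>2 * K_factor n I * indicator I i"

definition marginal :: "nat \<Rightarrow> real \<Rightarrow> (nat \<Rightarrow> real) \<Rightarrow> nat set \<Rightarrow> real" where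
  "marginal n \<sigma> X I =
     (\<Prod>i\<in>{1..n}. normal_density (X i * indicator I i) (sqrt (\<sigma>\<^sup>2 + tau_sq n \<sigma> I i)) (X i))"

definition post_weight :: "real \<Rightarrow> nat \<Rightarrow> real \<Rightarrow> (nat \<Rightarrow> real) \<Rightarrow> nat set \<Rightarrow> real" where
  "post_weight \<kappa> n \<sigma> X I =
     prior_weight \<kappa> n I * marginal n \<sigma> X I /
     (\<Sum>J\<in>Pow {1..n}. prior_weight \<kappa> n J * marginal n \<sigma> X J)"

definition cond_post :: "nat \<Rightarrow> real \<Rightarrow> (nat \<Rightarrow> real) \<Rightarrow> nat set \<Rightarrow> (nat \<Rightarrow> real) measure" where
  "cond_post n \<sigma> X I =
     Pi\<^sub>M {1..n} (\<lambda>i. normal_law (X i * indicator I i)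
                       (K_factor n I * \<sigma>\<^sup>2 * indicator I i / (K_factor n I + 1)))"

definition mixed_post :: "real \<Rightarrow> nat \<Rightarrow> real \<Rightarrow> (nat \<Rightarrow> real) \<Rightarrow> (nat \<Rightarrow> real) measure" where
  "mixed_post \<kappa> n \<sigma> X =
     measure_of (space (Rn n)) (sets (Rn n))
       (\<lambda>A. \<Sum>I\<in>Pow {1..n}. ennreal (post_weight \<kappa> n \<sigma> X I) * emeasure (cond_post n \<sigma> X I) A)"

lemma sets_normal_law [simp]: "sets (normal_law \<mu> v) = sets borel"
  by (simp add: normal_law_def)

lemma prob_space_normal_law:
  assumes "v \<ge> 0" shows "prob_space (normal_law \<mu> v)"
  using assms by (auto simp: normal_law_def intro!: prob_space_return prob_space_normal_density)

lemma sets_cond_post [simp]: "sets (cond_post n \<sigma> X I) = sets (Rn n)"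
  unfolding cond_post_def by (rule sets_PiM_cong) auto

lemma K_factor_nonneg:
  assumes "I \<subseteq> {1..n}" shows "K_factor n I \<ge> 0"
proof (cases "I = {}")
  case False
  have f: "finite I" using assms finite_subset by blast
  have "card I \<le> card {1..n}" using assms by (intro card_mono) auto
  then have c: "real (card I) \<le> real n" "0 < card I" using False f by (auto simp: card_gt_0_iff)
  have "1 * real (card I) \<le> exp 1 * real n"
    using c exp_ge_add_one_self[of 1] by (intro mult_mono) auto
  then show ?thesis using c False by (simp add: K_factor_def field_simps)
qed (simp add: K_factor_def)

lemma prob_space_cond_post:
  assumes "I \<subseteq> {1..n}" shows "prob_space (cond_post n \<sigma> X I)"
  unfolding cond_post_def
  using K_factor_nonneg[OF assms] by (intro prob_space_PiM prob_space_normal_law) simp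

text \<open>Since \<open>measure_of\<close> yields the null measure if its argument is not countably additive,
  we check that the mixture has the intended values and total mass \<open>1\<close>.\<close>

lemma sets_mixed_post [simp]: "sets (mixed_post \<kappa> n \<sigma> X) = sets (Rn n)"
  unfolding mixed_post_def by (simp add: sets.sigma_sets_eq sets.space_closed)

lemma space_mixed_post [simp]: "space (mixed_post \<kappa> n \<sigma> X) = space (Rn n)"
  by (rule sets_eq_imp_space_eq) simp

lemma emeasure_mixed_post:
  assumes "A \<in> sets (Rn n)"
  shows "emeasure (mixed_post \<kappa> n \<sigma> X) A =
    (\<Sum>I\<in>Pow {1..n}. ennreal (post_weight \<kappa> n \<sigma> X I) * emeasure (cond_post n \<sigma> X I) A)"
proof (rule emeasure_measure_of[OF mixed_post_def])
  show "countably_additive (sets (mixed_post \<kappa> n \<sigma> X))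
    (\<lambda>A. \<Sum>I\<in>Pow {1..n}. ennreal (post_weight \<kappa> n \<sigma> X I) * emeasure (cond_post n \<sigma> X I) A)"
  proof (rule countably_additiveI)
    fix F :: "nat \<Rightarrow> (nat \<Rightarrow> real) set"
    assume F: "range F \<subseteq> sets (mixed_post \<kappa> n \<sigma> X)" "disjoint_family F"
    have *: "(\<Sum>k. emeasure (cond_post n \<sigma> X I) (F k)) = emeasure (cond_post n \<sigma> X I) (\<Union>k. F k)" for I
      using F by (intro suminf_emeasure) auto
    show "(\<Sum>k. \<Sum>I\<in>Pow {1..n}. ennreal (post_weight \<kappa> n \<sigma> X I) * emeasure (cond_post n \<sigma> X I) (F k)) =
      (\<Sum>I\<in>Pow {1..n}. ennreal (post_weight \<kappa> n \<sigma> X I) * emeasure (cond_post n \<sigma> X I) (\<Union>k. F k))"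
      by (subst suminf_sum) (auto simp: *)
  qed
qed (use assms in \<open>auto simp: positive_def dest: sets.sets_into_space\<close>)

lemma prior_unnorm_pos:
  assumes "I \<subseteq> {1..n}" shows "prior_unnorm \<kappa> n I > 0"
proof (cases "I = {}")
  case False
  then have "n \<noteq> 0" "card I \<noteq> 0" using assms finite_subset[OF assms] by auto
  then show ?thesis using False by (simp add: prior_unnorm_def)
qed (simp add: prior_unnorm_def)

lemma prior_weight_pos:
  assumes "I \<subseteq> {1..n}" shows "prior_weight \<kappa> n I > 0"
  unfolding prior_weight_def
  using assms by (intro divide_pos_pos sum_pos) (auto simp: prior_unnorm_pos)

lemma marginal_pos:
  assumes "I \<subseteq> {1..n}" "\<sigma> > 0" shows "marginal n \<sigma> X I > 0"
  unfolding marginal_def tau_sq_def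
  using K_factor_nonneg[OF assms(1)] assms(2)
  by (intro prod_pos normal_density_pos) (simp add: add_pos_nonneg)

lemma post_weight_pos:
  assumes "I \<subseteq> {1..n}" "\<sigma> > 0" shows "post_weight \<kappa> n \<sigma> X I > 0"
  unfolding post_weight_def
  using assms by (intro divide_pos_pos sum_pos) (auto simp: prior_weight_pos marginal_pos)

lemma sum_post_weight:
  assumes "\<sigma> > 0" shows "(\<Sum>I\<in>Pow {1..n}. post_weight \<kappa> n \<sigma> X I) = 1"
proof -
  have "(\<Sum>J\<in>Pow {1..n}. prior_weight \<kappa> n J * marginal n \<sigma> X J) > 0"
    using assms by (intro sum_pos) (auto simp: prior_weight_pos marginal_pos)
  then show ?thesis by (simp add: post_weight_def flip: sum_divide_distrib)
qed

lemma prob_space_mixed_post: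
  assumes "\<sigma> > 0" shows "prob_space (mixed_post \<kappa> n \<sigma> X)"
proof (rule prob_spaceI)
  have "emeasure (cond_post n \<sigma> X I) (space (Rn n)) = 1" if "I \<subseteq> {1..n}" for I
    using prob_space.emeasure_space_1[OF prob_space_cond_post[OF that]]
    by (simp add: sets_eq_imp_space_eq[OF sets_cond_post])
  then have "emeasure (mixed_post \<kappa> n \<sigma> X) (space (Rn n)) =
      (\<Sum>I\<in>Pow {1..n}. ennreal (post_weight \<kappa> n \<sigma> X I))"
    by (subst emeasure_mixed_post) auto
  also have "\<dots> = ennreal (\<Sum>I\<in>Pow {1..n}. post_weight \<kappa> n \<sigma> X I)"
    by (intro sum_ennreal less_imp_le[OF post_weight_pos]) (use assms in auto)
  finally show "emeasure (mixed_post \<kappa> n \<sigma> X) (space (mixed_post \<kappa> n \<sigma> X)) = 1"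
    by (simp only: space_mixed_post sum_post_weight[OF assms] ennreal_1)
qed

definition mixed_mean :: "real \<Rightarrow> nat \<Rightarrow> real \<Rightarrow> (nat \<Rightarrow> real) \<Rightarrow> nat \<Rightarrow> real" where
  "mixed_mean \<kappa> n \<sigma> X =
     (\<lambda>i\<in>{1..n}. \<Sum>I\<in>Pow {1..n}. restr n X I i * post_weight \<kappa> n \<sigma> X I)"

text \<open>A choice of maximizer of the posterior weights. There may be ties, and a selector that breaks
  them non-measurably would leave the probabilities below undefined.\<close>

definition map_selector :: "real \<Rightarrow> nat \<Rightarrow> real \<Rightarrow> ((nat \<Rightarrow> real) \<Rightarrow> nat set) \<Rightarrow> bool" where
  "map_selector \<kappa> n \<sigma> Ihat \<longleftrightarrow>
     Ihat \<in> measurable (Rn n) (count_space (Pow {1..n})) \<and>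
     (\<forall>X\<in>space (Rn n). is_arg_max (post_weight \<kappa> n \<sigma> X) (\<lambda>I. I \<subseteq> {1..n}) (Ihat X))"

text \<open>For \<open>I = {}\<close> the logarithmic term vanishes, as the factor \<open>card I\<close> is \<open>0\<close>.\<close>

definition rate_sq :: "nat \<Rightarrow> real \<Rightarrow> nat set \<Rightarrow> (nat \<Rightarrow> real) \<Rightarrow> real" where
  "rate_sq n \<sigma> I \<theta> =
     (\<Sum>i\<in>{1..n} - I. (\<theta> i)\<^sup>2) + \<sigma>\<^sup>2 * real (card I) * ln (exp 1 * real n / real (card I))"

definition oracle_rate_sq :: "nat \<Rightarrow> real \<Rightarrow> (nat \<Rightarrow> real) \<Rightarrow> real" where
  "oracle_rate_sq n \<sigma> \<theta> = Min ((\<lambda>I. rate_sq n \<sigma> I \<theta>) ` Pow {1..n})"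

text \<open>The pairs (posterior distribution, estimator), both as functions of the data.\<close>

definition eb_procedure ::
  "real \<Rightarrow> nat \<Rightarrow> real \<Rightarrow> ((nat \<Rightarrow> real) \<Rightarrow> (nat \<Rightarrow> real) measure) \<Rightarrow> ((nat \<Rightarrow> real) \<Rightarrow> nat \<Rightarrow> real) \<Rightarrow> bool"
where
  "eb_procedure \<kappa> n \<sigma> post est \<longleftrightarrow>
     (post = mixed_post \<kappa> n \<sigma> \<and> est = mixed_mean \<kappa> n \<sigma>) \<or>
     (\<exists>Ihat. map_selector \<kappa> n \<sigma> Ihat \<and>
        post = (\<lambda>X. cond_post n \<sigma> X (Ihat X)) \<and> est = (\<lambda>X. restr n X (Ihat X)))"

end

theory Submission
  imports Defs
begin

text \<open>Write \<open>J\<close> for an oracle set. Every posterior weight, and likewise the indicator that a set is the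
  selected one, is at most \<open>min 1 \<rho>\<close> for its posterior odds \<open>\<rho>\<close> against \<open>J\<close>, hence at most \<open>\<rho>\<^sup>h\<close> for any
  \<open>h \<in> [0, 1]\<close>. Both procedures are mixtures with such weights, so by Markov's and Jensen's
  inequalities both claims reduce to one bound on the expectation of \<open>\<Sum>\<^sub>I \<rho>\<^sub>I\<^sup>h exp (s D\<^sub>I / \<sigma>\<^sup>2 + |I| / 2)\<close>,
  where \<open>D\<^sub>I\<close> is the loss of \<open>X(I)\<close>. If \<open>s + h = \<beta>\<close> and \<open>4 s \<le> h\<close>, the exponent is at most
  \<open>\<beta> \<Sum>\<^sub>i \<xi>\<^sub>i\<^sup>2\<close> over \<open>i \<in> I \<union> J\<close>, plus a multiple of the oracle rate, minus \<open>h (\<kappa> + 1/2)\<close> times the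
  penalty \<open>|I| log (e n / |I|)\<close>. The condition on \<open>\<kappa>\<close> allows \<open>h (\<kappa> + 1/2) \<ge> B + 2\<close>, which leaves
  enough of the penalty to sum over all subsets.\<close>

section \<open>Penalties of subsets and sums over all subsets\<close>

declare One_nat_def [simp del]

definition pen :: "nat \<Rightarrow> nat set \<Rightarrow> real" where
  "pen n I = real (card I) * ln (exp 1 * real n / real (card I))"

text \<open>Up to a term free of \<open>I\<close>, this is \<open>- 2 * \<sigma>\<^sup>2\<close>
  times the logarithm of the posterior weight. In the factor \<open>2 * \<kappa> + 1\<close>, the
  prior accounts for \<open>2 * \<kappa>\<close> and the normalizing constants of the marginal for
  the remaining \<open>1\<close>.\<close>

definition crit :: "real \<Rightarrow> nat \<Rightarrow> real \<Rightarrow> (nat \<Rightarrow> real) \<Rightarrow> nat set \<Rightarrow> real" where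
  "crit \<kappa> n \<sigma> X I = (\<Sum>i\<in>{1..n} - I. (X i)\<^sup>2) + (2 * \<kappa> + 1) * \<sigma>\<^sup>2 * pen n I"

definition loss :: "nat \<Rightarrow> (nat \<Rightarrow> real) \<Rightarrow> (nat \<Rightarrow> real) \<Rightarrow> nat set \<Rightarrow> real" where
  "loss n \<theta> X I = (\<Sum>i\<in>{1..n}. (X i * indicator I i - \<theta> i)\<^sup>2)"

lemma card_subset_bounds:
  assumes "I \<subseteq> {1..n::nat}"
  shows "finite I" "card I \<le> n"
proof -
  show "finite I" using assms finite_subset by blast
  show "card I \<le> n" using card_mono[OF _ assms] by simp
qed

text \<open>Since |I| is at most n, the argument of the logarithm is at least e. This lets every
  cardinality, in particular those from the exponential moment condition, be charged to the
  penalty.\<close>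

lemma card_le_pen:
  assumes "I \<subseteq> {1..n}"
  shows "real (card I) \<le> pen n I"
proof (cases "card I = 0")
  case False
  have "exp 1 \<le> exp 1 * real n / real (card I)"
  proof -
    have "exp 1 * real (card I) \<le> exp 1 * real n"
      using card_subset_bounds(2)[OF assms] by simp
    then show ?thesis using False by (simp add: pos_le_divide_eq)
  qed
  then have "1 \<le> ln (exp 1 * real n / real (card I))"
    by (metis exp_gt_zero ln_exp ln_le_cancel_iff order_less_le_trans)
  then show ?thesis unfolding pen_def
    by (metis mult.right_neutral mult_left_mono of_nat_0_le_iff)
qed (simp add: pen_def)

text \<open>Combines (n choose k) <= n^k / k! with k! >= (k / e)^k. Thus the penalty dominates the
  logarithm of the number of sets of a given size.\<close>

lemma binomial_le_exp_pen:
  assumes "0 < k" "k \<le> n"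
  shows "real (n choose k) \<le> exp (real k * ln (exp 1 * real n / real k))"
proof -
  \<comment> \<open>A single term of the series of exp k, all of whose terms are
    nonnegative.\<close>
  have "real k ^ k / fact k \<le> exp (real k)"
    using sum_le_suminf[of "\<lambda>j. real k ^ j /\<^sub>R fact j" "{k}"] summable_exp_generic[of "real k"]
    by (simp add: exp_def divide_inverse mult.commute)
  then have "real k ^ k \<le> exp (real k) * fact k" by (simp add: field_simps)
  then have *: "1 / fact k \<le> exp (real k) / real k ^ k"
    using assms by (simp add: field_simps)
  have "real (n choose k) * fact k \<le> real n ^ k"
    using binomial_fact_pow[of n k] by (metis of_nat_fact of_nat_le_iff of_nat_mult of_nat_power)
  then have "real (n choose k) \<le> real n ^ k * (1 / fact k)" by (simp add: field_simps)
  also have "\<dots> \<le> real n ^ k * (exp (real k) / real k ^ k)"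
    using * by (intro mult_left_mono) auto
  also have "\<dots> = (exp 1 * real n / real k) ^ k"
    by (simp add: power_divide power_mult_distrib flip: exp_of_nat_mult)
  also have "\<dots> = exp (real k * ln (exp 1 * real n / real k))"
    using assms by (simp add: exp_of_nat_mult)
  finally show ?thesis .
qed

text \<open>Subsets are grouped by their size k. Of the coefficient 3/2, one unit pays for the
  number of subsets of size k; the remaining half is at least k/2 and leaves a geometric series, so
  the bound is uniform in n.\<close>

lemma sum_Pow_exp_pen_le:
  "(\<Sum>I\<in>Pow {1..n}. exp (- (3 / 2) * pen n I)) \<le> 1 / (1 - exp (- 1 / 2))"
proof -
  let ?f = "\<lambda>k. exp (- (3 / 2) * (real k * ln (exp 1 * real n / real k)))"
  let ?S = "\<lambda>k. {I. I \<subseteq> {1..n} \<and> card I = k}"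
  have fin: "finite (?S k)" for k by (rule finite_subset[of _ "Pow {1..n}"]) auto
  have Pow_eq: "Pow {1..n} = (\<Union>k\<in>{..n}. ?S k)" using card_subset_bounds(2)[of _ n] by auto
  have "(\<Sum>I\<in>Pow {1..n}. exp (- (3 / 2) * pen n I)) = (\<Sum>k\<le>n. \<Sum>I\<in>?S k. exp (- (3 / 2) * pen n I))"
    unfolding Pow_eq by (rule sum.UNION_disjoint) (use fin in auto)
  also have "\<dots> = (\<Sum>k\<le>n. real (n choose k) * ?f k)"
  proof (rule sum.cong[OF refl])
    fix k
    have "(\<Sum>I\<in>?S k. exp (- (3 / 2) * pen n I)) = (\<Sum>I\<in>?S k. ?f k)"
      by (rule sum.cong) (auto simp: pen_def)
    then show "(\<Sum>I\<in>?S k. exp (- (3 / 2) * pen n I)) = real (n choose k) * ?f k"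
      by (simp add: n_subsets)
  qed
  also have "\<dots> \<le> (\<Sum>k\<le>n. exp (- 1 / 2) ^ k)"
  proof (rule sum_mono)
    fix k assume k: "k \<in> {..n}"
    show "real (n choose k) * ?f k \<le> exp (- 1 / 2) ^ k"
    proof (cases "k = 0")
      case False
      let ?p = "real k * ln (exp 1 * real n / real k)"
      have "real (n choose k) * ?f k \<le> exp ?p * ?f k"
        using binomial_le_exp_pen[of k n] False k by (intro mult_right_mono) auto
      also have "\<dots> = exp (- (1 / 2) * ?p)" by (simp flip: exp_add)
      \<comment> \<open>Here \<open>{1..k}\<close> only represents the sets of size k, so that
        \<open>card_le_pen\<close> gives k <= \<open>?p\<close>.\<close>
      also have "\<dots> \<le> exp (real k * (- 1 / 2))"
        using card_le_pen[of "{1..k}" n] k by (simp add: pen_def)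
      finally show ?thesis by (simp only: exp_of_nat_mult)
    qed simp
  qed
  also have "\<dots> \<le> (\<Sum>k. exp (- 1 / 2) ^ k)"
    by (rule sum_le_suminf) (auto intro!: summable_geometric)
  also have "\<dots> = 1 / (1 - exp (- 1 / 2))"
    by (rule suminf_geometric) simp
  finally show ?thesis .
qed

section \<open>Closed form of the posterior weights; both procedures as mixtures\<close>

lemma prior_unnorm_eq:
  assumes "I \<subseteq> {1..n}"
  shows "prior_unnorm \<kappa> n I = exp (- \<kappa> * pen n I)"
proof (cases "I = {}")
  case False
  then have "card I > 0" "n > 0" using card_subset_bounds[OF assms] by (auto simp: card_gt_0_iff)
  then show ?thesis using False by (simp add: prior_unnorm_def pen_def powr_def)
qed (simp add: prior_unnorm_def pen_def)

text \<open>For i in I the normal density is evaluated at its own mean, so only its normalizing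
  constant remains, which is smaller by the factor (1 + K)^(-1/2). Coordinates outside I have mean 0
  and the variance of the noise model.\<close>

lemma marginal_eq:
  assumes "I \<subseteq> {1..n}" "\<sigma> > 0"
  shows "marginal n \<sigma> X I =
    (1 / sqrt (2 * pi * \<sigma>\<^sup>2)) ^ n * exp (- (\<Sum>i\<in>{1..n} - I. (X i)\<^sup>2) / (2 * \<sigma>\<^sup>2) - pen n I / 2)"
proof -
  let ?L = "ln (1 + K_factor n I)"
  have K: "1 + K_factor n I > 0" using K_factor_nonneg[OF assms(1)] by linarith
  have s: "exp (- (?L / 2)) = 1 / sqrt (1 + K_factor n I)"
  proof -
    have "exp (?L / 2) = sqrt (1 + K_factor n I)"
      using K by (simp flip: ln_sqrt)
    then show ?thesis by (simp add: exp_minus inverse_eq_divide)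
  qed
  have "marginal n \<sigma> X I =
    (\<Prod>i\<in>{1..n}. (1 / sqrt (2 * pi * \<sigma>\<^sup>2)) * exp (if i \<in> I then - (?L / 2) else - (X i)\<^sup>2 / (2 * \<sigma>\<^sup>2)))"
    unfolding marginal_def
  proof (rule prod.cong[OF refl])
    fix i
    show "normal_density (X i * indicator I i) (sqrt (\<sigma>\<^sup>2 + tau_sq n \<sigma> I i)) (X i) =
      1 / sqrt (2 * pi * \<sigma>\<^sup>2) * exp (if i \<in> I then - (?L / 2) else - (X i)\<^sup>2 / (2 * \<sigma>\<^sup>2))"
    proof (cases "i \<in> I")
      case True
      have "\<sigma>\<^sup>2 + \<sigma>\<^sup>2 * K_factor n I = \<sigma>\<^sup>2 * (1 + K_factor n I)" by (simp add: algebra_simps)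
      then show ?thesis using True K
        by (simp add: normal_density_def tau_sq_def s real_sqrt_mult)
    qed (simp add: normal_density_def tau_sq_def)
  qed
  also have "\<dots> = (1 / sqrt (2 * pi * \<sigma>\<^sup>2)) ^ n *
      exp (\<Sum>i\<in>{1..n}. if i \<in> I then - (?L / 2) else - (X i)\<^sup>2 / (2 * \<sigma>\<^sup>2))"
    by (simp only: prod.distrib exp_sum prod_constant finite_atLeastAtMost card_atLeastAtMost) simp
  also have "(\<Sum>i\<in>{1..n}. if i \<in> I then - (?L / 2) else - (X i)\<^sup>2 / (2 * \<sigma>\<^sup>2)) =
      (\<Sum>i\<in>{1..n} \<inter> I. - (?L / 2)) + (\<Sum>i\<in>{1..n} - I. - (X i)\<^sup>2 / (2 * \<sigma>\<^sup>2))"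
    by (subst sum.If_cases) (auto simp: Diff_eq)
  also have "{1..n} \<inter> I = I" using assms by auto
  \<comment> \<open>For nonempty I, 1 + K is en/|I|, so |I| copies of half its logarithm make up
    half the penalty.\<close>
  also have "(\<Sum>i\<in>I. - (?L / 2)) = - pen n I / 2"
    by (cases "I = {}") (auto simp: pen_def K_factor_def)
  also have "(\<Sum>i\<in>{1..n} - I. - (X i)\<^sup>2 / (2 * \<sigma>\<^sup>2)) = - (\<Sum>i\<in>{1..n} - I. (X i)\<^sup>2) / (2 * \<sigma>\<^sup>2)"
    by (simp add: sum_divide_distrib sum_negf)
  finally show ?thesis by (simp add: add.commute)
qed

text \<open>The normalizations of prior and posterior and the common Gaussian constant do not depend
  on the set, so they cancel in the odds.\<close>

lemma post_weight_ratio: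
  assumes "I \<subseteq> {1..n}" "J \<subseteq> {1..n}" "\<sigma> > 0"
  shows "post_weight \<kappa> n \<sigma> X I =
    post_weight \<kappa> n \<sigma> X J * exp ((crit \<kappa> n \<sigma> X J - crit \<kappa> n \<sigma> X I) / (2 * \<sigma>\<^sup>2))"
proof -
  define c where "c = (1 / sqrt (2 * pi * \<sigma>\<^sup>2)) ^ n / (\<Sum>J\<in>Pow {1..n}. prior_unnorm \<kappa> n J)"
  define d where "d = (\<Sum>J\<in>Pow {1..n}. prior_weight \<kappa> n J * marginal n \<sigma> X J)"
  have "post_weight \<kappa> n \<sigma> X I = c / d * exp (- crit \<kappa> n \<sigma> X I / (2 * \<sigma>\<^sup>2))" if "I \<subseteq> {1..n}" for I
  proof -
    have "- crit \<kappa> n \<sigma> X I / (2 * \<sigma>\<^sup>2) =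
        - \<kappa> * pen n I + (- (\<Sum>i\<in>{1..n} - I. (X i)\<^sup>2) / (2 * \<sigma>\<^sup>2) - pen n I / 2)"
      using assms(3) by (simp add: crit_def field_simps)
    then have "exp (- crit \<kappa> n \<sigma> X I / (2 * \<sigma>\<^sup>2)) = exp (- \<kappa> * pen n I) *
        exp (- (\<Sum>i\<in>{1..n} - I. (X i)\<^sup>2) / (2 * \<sigma>\<^sup>2) - pen n I / 2)"
      by (simp only: exp_add)
    then show ?thesis unfolding post_weight_def d_def[symmetric] unfolding prior_weight_def
      prior_unnorm_eq[OF that] marginal_eq[OF that assms(3)] by (simp add: c_def)
  qed
  note * = this[OF assms(1)] this[OF assms(2)]
  show ?thesis unfolding * mult.assoc exp_add[symmetric]
    by (simp add: diff_divide_distrib)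
qed

lemma post_weight_le_1:
  assumes "I \<subseteq> {1..n}" "\<sigma> > 0"
  shows "post_weight \<kappa> n \<sigma> X I \<le> 1"
  using member_le_sum[of I "Pow {1..n}" "post_weight \<kappa> n \<sigma> X"] assms
  by (simp add: sum_post_weight less_imp_le[OF post_weight_pos])

lemma post_weight_le_exp:
  assumes "I \<subseteq> {1..n}" "J \<subseteq> {1..n}" "\<sigma> > 0" "0 \<le> h" "h \<le> 1"
  shows "post_weight \<kappa> n \<sigma> X I \<le> exp (h * ((crit \<kappa> n \<sigma> X J - crit \<kappa> n \<sigma> X I) / (2 * \<sigma>\<^sup>2)))"
proof -
  define e where "e = (crit \<kappa> n \<sigma> X J - crit \<kappa> n \<sigma> X I) / (2 * \<sigma>\<^sup>2)"
  have "post_weight \<kappa> n \<sigma> X I \<le> 1 * exp e"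
    unfolding post_weight_ratio[OF assms(1-3)] e_def
    by (intro mult_right_mono post_weight_le_1) (use assms in auto)
  moreover have "post_weight \<kappa> n \<sigma> X I \<le> exp 0" using assms by (simp add: post_weight_le_1)
  ultimately have "post_weight \<kappa> n \<sigma> X I \<le> exp (min 0 e)" by (simp add: min_def)
  \<comment> \<open>If \<open>e\<close> is nonnegative, the minimum is 0 and \<open>h * e\<close> is
    at least 0; if \<open>e\<close> is negative, h <= 1 gives \<open>e\<close> <=
    \<open>h * e\<close>.\<close>
  also have "\<dots> \<le> exp (h * e)"
    using assms(4,5) mult_right_mono_neg[of h 1 e] by (cases "e \<ge> 0") (auto simp: min_def)
  finally show ?thesis unfolding e_def .
qed

lemma map_crit_le:
  assumes "map_selector \<kappa> n \<sigma> Ihat" "X \<in> space (Rn n)" "J \<subseteq> {1..n}" "\<sigma> > 0"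
  shows "Ihat X \<subseteq> {1..n}" "crit \<kappa> n \<sigma> X (Ihat X) \<le> crit \<kappa> n \<sigma> X J"
proof -
  have m: "is_arg_max (post_weight \<kappa> n \<sigma> X) (\<lambda>I. I \<subseteq> {1..n}) (Ihat X)"
    using assms by (auto simp: map_selector_def)
  then show I: "Ihat X \<subseteq> {1..n}" by (simp add: is_arg_max_def)
  have le: "post_weight \<kappa> n \<sigma> X J \<le> post_weight \<kappa> n \<sigma> X (Ihat X)"
    using m assms(3) by (auto simp: is_arg_max_def not_less)
  show "crit \<kappa> n \<sigma> X (Ihat X) \<le> crit \<kappa> n \<sigma> X J"
    using le post_weight_pos[OF assms(3,4), of \<kappa> X] assms(4)
    unfolding post_weight_ratio[OF I assms(3,4)]
    by (simp add: mult_le_cancel_left1 zero_le_divide_iff)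
qed

text \<open>A common form of the two procedures, through which all later arguments go:
  \<open>w\<close> is the posterior weight for the model average and the point mass at
  \<open>Ihat X\<close> for the selected model.\<close>

lemma eb_procedure_mixture:
  assumes "eb_procedure \<kappa> n \<sigma> post est" "X \<in> space (Rn n)" "J \<subseteq> {1..n}" "\<sigma> > 0" "0 \<le> h" "h \<le> 1"
  obtains w where
    "\<And>I. I \<subseteq> {1..n} \<Longrightarrow> 0 \<le> w I"
    "\<And>I. I \<subseteq> {1..n} \<Longrightarrow> w I \<le> exp (h * ((crit \<kappa> n \<sigma> X J - crit \<kappa> n \<sigma> X I) / (2 * \<sigma>\<^sup>2)))"
    "(\<Sum>I\<in>Pow {1..n}. w I) = 1"
    "\<And>A. A \<in> sets (Rn n) \<Longrightarrow>
       emeasure (post X) A = (\<Sum>I\<in>Pow {1..n}. ennreal (w I) * emeasure (cond_post n \<sigma> X I) A)"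
    "\<And>i. i \<in> {1..n} \<Longrightarrow> est X i = (\<Sum>I\<in>Pow {1..n}. w I * (X i * indicator I i))"
proof -
  from assms(1) consider
    "post = mixed_post \<kappa> n \<sigma>" "est = mixed_mean \<kappa> n \<sigma>"
  | Ihat where "map_selector \<kappa> n \<sigma> Ihat"
      "post = (\<lambda>X. cond_post n \<sigma> X (Ihat X))" "est = (\<lambda>X. restr n X (Ihat X))"
    unfolding eb_procedure_def by blast
  then show ?thesis
  proof cases
    case 1
    show ?thesis
      by (rule that[of "post_weight \<kappa> n \<sigma> X"])
        (use assms 1 post_weight_le_exp[OF _ assms(3-6)] in \<open>auto simp: sum_post_weight
          emeasure_mixed_post mixed_mean_def restr_def mult.commute less_imp_le[OF post_weight_pos]\<close>)
  next
    case 2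
    note m = map_crit_le[OF 2(1) assms(2) _ assms(4)]
    define w :: "nat set \<Rightarrow> real" where "w = (\<lambda>I. if I = Ihat X then 1 else 0)"
    have w: "(\<Sum>I\<in>Pow {1..n}. w I * f I) = f (Ihat X)" for f
    proof -
      have "(\<Sum>I\<in>Pow {1..n}. w I * f I) = (\<Sum>I\<in>Pow {1..n}. if I = Ihat X then f I else 0)"
        by (rule sum.cong) (auto simp: w_def)
      then show ?thesis using m(1)[OF assms(3)] by (simp add: sum.delta')
    qed
    have w': "(\<Sum>I\<in>Pow {1..n}. ennreal (w I) * f I) = f (Ihat X)" for f
    proof -
      have "(\<Sum>I\<in>Pow {1..n}. ennreal (w I) * f I) = (\<Sum>I\<in>Pow {1..n}. if I = Ihat X then f I else 0)"
        by (rule sum.cong) (auto simp: w_def)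
      then show ?thesis using m(1)[OF assms(3)] by (simp add: sum.delta')
    qed
    show ?thesis
    proof (rule that[of w])
      \<comment> \<open>At the selected set the exponent is nonnegative, because its criterion is at
        most that of \<open>J\<close>; all other weights are 0.\<close>
      show "w I \<le> exp (h * ((crit \<kappa> n \<sigma> X J - crit \<kappa> n \<sigma> X I) / (2 * \<sigma>\<^sup>2)))" for I
        using m(2)[OF assms(3)] assms by (auto simp: w_def)
    qed (use w[of "\<lambda>_. 1"] w w' 2 in \<open>auto simp: w_def restr_def\<close>)
  qed
qed

section \<open>Exponential moments of the Gaussian conditional posteriors\<close>

text \<open>Splitting (x - t)^2 <= 2 (x - \<mu>)^2 + 2 (\<mu> - t)^2 separates the bias from a
  centred Gaussian moment. The factor 2 is why the rate is s / 2 on the left and s on the right. A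
  Dirac measure has no variance to pay for, hence the case distinction in the bound.\<close>

lemma nn_integral_exp_normal_law:
  fixes \<mu> t \<sigma> v s :: real
  assumes "\<sigma> > 0" "0 \<le> v" "v \<le> \<sigma>\<^sup>2" "0 \<le> s" "s \<le> 1 / 5"
  shows "(\<integral>\<^sup>+x. ennreal (exp (s / (2 * \<sigma>\<^sup>2) * (x - t)\<^sup>2)) \<partial>normal_law \<mu> v)
    \<le> ennreal (exp (s / \<sigma>\<^sup>2 * (\<mu> - t)\<^sup>2 + (if v = 0 then 0 else 1 / 2)))"
proof (cases "v = 0")
  case True
  then show ?thesis using assms
    by (auto simp: normal_law_def nn_integral_return field_simps intro!: ennreal_leI mult_right_mono)
next
  case False
  \<comment> \<open>Tilting N(\<mu>, v) by the centred quadratic term gives a multiple of the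
    density of N(\<mu>, v / q). The bound s <= 1/5 keeps \<open>q\<close> away from 0.\<close>
  define q where "q = 1 - 2 * s * v / \<sigma>\<^sup>2"
  define c where "c = exp (s / \<sigma>\<^sup>2 * (\<mu> - t)\<^sup>2)"
  have v: "v > 0" using False assms by simp
  have "s * v \<le> 1 / 5 * \<sigma>\<^sup>2" using assms by (intro mult_mono) auto
  then have q: "q \<ge> 3 / 5" using assms by (simp add: q_def field_simps)
  \<comment> \<open>The constant 1 / sqrt q left by the tilting is to be absorbed into exp (1/2),
    which amounts to exp (-1) <= q.\<close>
  have "exp (1::real) \<ge> 2" using exp_ge_add_one_self[of 1] by simp
  then have "exp (-1::real) \<le> 1 / 2" by (simp add: exp_minus field_simps)
  then have "exp (-1::real) \<le> q" using q by linarith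
  then have "exp (- 1 / 2::real) \<le> sqrt q"
    by (intro real_le_rsqrt) (simp flip: exp_of_nat_mult)
  then have sq: "1 / sqrt q \<le> exp (1 / 2)"
    using q by (simp add: exp_minus field_simps)
  have sv: "sqrt (v / q) > 0" using v q by simp
  have pw: "exp (s / (2 * \<sigma>\<^sup>2) * (x - t)\<^sup>2) * normal_density \<mu> (sqrt v) x
      \<le> c / sqrt q * normal_density \<mu> (sqrt (v / q)) x" for x
  proof -
    have "0 \<le> (x - \<mu> - (\<mu> - t))\<^sup>2" by simp
    then have "(x - t)\<^sup>2 \<le> 2 * (x - \<mu>)\<^sup>2 + 2 * (\<mu> - t)\<^sup>2"
      by (simp add: power2_eq_square algebra_simps)
    then have "s / (2 * \<sigma>\<^sup>2) * (x - t)\<^sup>2 \<le> s / (2 * \<sigma>\<^sup>2) * (2 * (x - \<mu>)\<^sup>2 + 2 * (\<mu> - t)\<^sup>2)"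
      using assms by (intro mult_left_mono) auto
    moreover have "- (x - \<mu>)\<^sup>2 / (2 * (v / q)) = - (x - \<mu>)\<^sup>2 / (2 * v) + s / \<sigma>\<^sup>2 * (x - \<mu>)\<^sup>2"
      using v q assms by (simp add: q_def field_simps)
    moreover have "s / (2 * \<sigma>\<^sup>2) * (2 * (x - \<mu>)\<^sup>2 + 2 * (\<mu> - t)\<^sup>2) =
        s / \<sigma>\<^sup>2 * (x - \<mu>)\<^sup>2 + s / \<sigma>\<^sup>2 * (\<mu> - t)\<^sup>2"
      using assms by (simp add: field_simps)
    ultimately have "s / (2 * \<sigma>\<^sup>2) * (x - t)\<^sup>2 + - (x - \<mu>)\<^sup>2 / (2 * v)
        \<le> s / \<sigma>\<^sup>2 * (\<mu> - t)\<^sup>2 + - (x - \<mu>)\<^sup>2 / (2 * (v / q))"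
      by linarith
    then have le: "exp (s / (2 * \<sigma>\<^sup>2) * (x - t)\<^sup>2) * exp (- (x - \<mu>)\<^sup>2 / (2 * v))
        \<le> c * exp (- (x - \<mu>)\<^sup>2 / (2 * (v / q)))"
      unfolding c_def exp_add[symmetric] by simp
    have "1 / sqrt (2 * pi * v) = 1 / sqrt q * (1 / sqrt (2 * pi * (v / q)))"
      using v q by (simp add: real_sqrt_mult real_sqrt_divide)
    with mult_left_mono[OF le, of "1 / sqrt (2 * pi * v)"] v q show ?thesis
      by (simp add: normal_density_def mult_ac)
  qed
  have "(\<integral>\<^sup>+x. ennreal (exp (s / (2 * \<sigma>\<^sup>2) * (x - t)\<^sup>2)) \<partial>normal_law \<mu> v) =
      (\<integral>\<^sup>+x. ennreal (exp (s / (2 * \<sigma>\<^sup>2) * (x - t)\<^sup>2) * normal_density \<mu> (sqrt v) x) \<partial>lborel)"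
    using False by (simp add: normal_law_def nn_integral_density ennreal_mult' mult.commute)
  also have "\<dots> \<le> (\<integral>\<^sup>+x. ennreal (c / sqrt q) * ennreal (normal_density \<mu> (sqrt (v / q)) x) \<partial>lborel)"
    using pw q by (intro nn_integral_mono) (simp add: c_def ennreal_leI flip: ennreal_mult')
  also have "\<dots> = ennreal (c / sqrt q)"
  proof -
    interpret prob_space "density lborel (normal_density \<mu> (sqrt (v / q)))"
      using sv by (rule prob_space_normal_density)
    show ?thesis using emeasure_space_1 by (simp add: nn_integral_cmult emeasure_density)
  qed
  also have "\<dots> \<le> ennreal (exp (s / \<sigma>\<^sup>2 * (\<mu> - t)\<^sup>2 + (if v = 0 then 0 else 1 / 2)))"
    using mult_left_mono[OF sq, of c] False by (intro ennreal_leI) (simp add: c_def exp_add)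
  finally show ?thesis .
qed

text \<open>The integral factorizes over coordinates. Those outside I have variance 0, so the cost
  1/2 is paid only |I| times.\<close>

lemma nn_integral_exp_cond_post:
  assumes "I \<subseteq> {1..n}" "\<sigma> > 0" "0 \<le> s" "s \<le> 1 / 5"
  shows "(\<integral>\<^sup>+\<upsilon>. ennreal (exp (s / (2 * \<sigma>\<^sup>2) * (\<Sum>i\<in>{1..n}. (\<upsilon> i - \<theta> i)\<^sup>2))) \<partial>cond_post n \<sigma> X I)
    \<le> ennreal (exp (s / \<sigma>\<^sup>2 * loss n \<theta> X I + real (card I) / 2))"
proof -
  define v where "v = (\<lambda>i. K_factor n I * \<sigma>\<^sup>2 * indicator I i / (K_factor n I + 1))"
  define N where "N = (\<lambda>i. normal_law (X i * indicator I i) (v i))"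
  have K: "K_factor n I \<ge> 0" using assms by (intro K_factor_nonneg)
  have v0: "0 \<le> v i" for i using K by (simp add: v_def)
  have "K_factor n I * \<sigma>\<^sup>2 / (K_factor n I + 1) \<le> \<sigma>\<^sup>2" using K by (simp add: field_simps)
  then have v1: "v i \<le> \<sigma>\<^sup>2" for i by (cases "i \<in> I") (simp_all add: v_def)
  interpret N: prob_space "N i" for i unfolding N_def using v0 by (rule prob_space_normal_law)
  interpret product_sigma_finite N by standard
  have "(\<integral>\<^sup>+\<upsilon>. ennreal (exp (s / (2 * \<sigma>\<^sup>2) * (\<Sum>i\<in>{1..n}. (\<upsilon> i - \<theta> i)\<^sup>2))) \<partial>cond_post n \<sigma> X I) =
      (\<integral>\<^sup>+\<upsilon>. (\<Prod>i\<in>{1..n}. ennreal (exp (s / (2 * \<sigma>\<^sup>2) * (\<upsilon> i - \<theta> i)\<^sup>2))) \<partial>Pi\<^sub>M {1..n} N)"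
    unfolding cond_post_def N_def v_def by (simp only: sum_distrib_left exp_sum finite_atLeastAtMost) (simp add: prod_ennreal)
  also have "\<dots> = (\<Prod>i\<in>{1..n}. \<integral>\<^sup>+x. ennreal (exp (s / (2 * \<sigma>\<^sup>2) * (x - \<theta> i)\<^sup>2)) \<partial>N i)"
    by (rule product_nn_integral_prod) (auto simp: N_def measurable_cong_sets[OF sets_normal_law refl])
  also have "\<dots> \<le> (\<Prod>i\<in>{1..n}. ennreal (exp (s / \<sigma>\<^sup>2 * (X i * indicator I i - \<theta> i)\<^sup>2 + indicator I i / 2)))"
  proof (intro prod_mono_ennreal)
    fix i
    have "(\<integral>\<^sup>+x. ennreal (exp (s / (2 * \<sigma>\<^sup>2) * (x - \<theta> i)\<^sup>2)) \<partial>N i)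
      \<le> ennreal (exp (s / \<sigma>\<^sup>2 * (X i * indicator I i - \<theta> i)\<^sup>2 + (if v i = 0 then 0 else 1 / 2)))"
      unfolding N_def by (rule nn_integral_exp_normal_law[OF assms(2) v0 v1 assms(3,4)])
    also have "\<dots> \<le> ennreal (exp (s / \<sigma>\<^sup>2 * (X i * indicator I i - \<theta> i)\<^sup>2 + indicator I i / 2))"
      by (cases "i \<in> I") (auto simp: v_def)
    finally show "(\<integral>\<^sup>+x. ennreal (exp (s / (2 * \<sigma>\<^sup>2) * (x - \<theta> i)\<^sup>2)) \<partial>N i)
      \<le> ennreal (exp (s / \<sigma>\<^sup>2 * (X i * indicator I i - \<theta> i)\<^sup>2 + indicator I i / 2))" .
  qed
  also have "\<dots> = ennreal (exp (\<Sum>i\<in>{1..n}. s / \<sigma>\<^sup>2 * (X i * indicator I i - \<theta> i)\<^sup>2 + indicator I i / 2))"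
    by (simp add: prod_ennreal exp_sum)
  also have "(\<Sum>i\<in>{1..n}. s / \<sigma>\<^sup>2 * (X i * indicator I i - \<theta> i)\<^sup>2 + indicator I i / 2) =
      s / \<sigma>\<^sup>2 * loss n \<theta> X I + real (card I) / 2"
  proof -
    have "(\<Sum>i\<in>{1..n}. indicator I i / 2) = real (card I) / 2"
      using assms(1) by (simp add: indicator_def sum.If_cases Int_absorb1 flip: sum_divide_distrib)
    then show ?thesis by (simp add: loss_def sum.distrib sum_distrib_left)
  qed
  finally show ?thesis .
qed

section \<open>The key exponent bound and the expectation of the envelope\<close>

text \<open>The penalties separate off and the rest is compared coordinate by coordinate, in units
  of \<sigma>. A coordinate in I but not in J costs at most h + s = \<beta> times the squared noise.
  In J but not in I, the criterion gains about h/4 times the squared signal, which pays for the loss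
  s as 4 s <= h. In neither set, the signal is charged to the oracle bias.\<close>

lemma weighted_exponent_le:
  assumes "0 \<le> s" "4 * s \<le> h" "s + h = \<beta>" "\<sigma> > 0" "I \<subseteq> {1..n}" "J \<subseteq> {1..n}"
    and X: "\<And>i. i \<in> {1..n} \<Longrightarrow> X i = \<theta> i + \<sigma> * \<xi> i"
  shows "h * ((crit \<kappa> n \<sigma> X J - crit \<kappa> n \<sigma> X I) / (2 * \<sigma>\<^sup>2)) + s / \<sigma>\<^sup>2 * loss n \<theta> X I
    \<le> \<beta> * (\<Sum>i\<in>I \<union> J. (\<xi> i)\<^sup>2) + \<beta> / \<sigma>\<^sup>2 * (\<Sum>i\<in>{1..n} - J. (\<theta> i)\<^sup>2)
      + h * (\<kappa> + 1 / 2) * (pen n J - pen n I)"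
proof -
  define a where "a = (\<lambda>i. h / (2 * \<sigma>\<^sup>2) *
    ((if i \<in> J then 0 else (X i)\<^sup>2) - (if i \<in> I then 0 else (X i)\<^sup>2)) + s / \<sigma>\<^sup>2 * (X i * indicator I i - \<theta> i)\<^sup>2)"
  define b where "b = (\<lambda>i. \<beta> * (if i \<in> I \<union> J then (\<xi> i)\<^sup>2 else 0) + \<beta> / \<sigma>\<^sup>2 * (if i \<in> J then 0 else (\<theta> i)\<^sup>2))"
  have D: "(\<Sum>i\<in>{1..n} - A. f i) = (\<Sum>i\<in>{1..n}. if i \<in> A then 0 else f i)" for A and f :: "nat \<Rightarrow> real"
    by (rule sum.mono_neutral_cong_left) auto
  have U: "(\<Sum>i\<in>I \<union> J. (\<xi> i)\<^sup>2) = (\<Sum>i\<in>{1..n}. if i \<in> I \<union> J then (\<xi> i)\<^sup>2 else 0)"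
    by (rule sum.mono_neutral_cong_left) (use assms in auto)
  have ab: "a i \<le> b i" if i: "i \<in> {1..n}" for i
  proof -
    define x where "x = \<xi> i"
    define t where "t = \<theta> i / \<sigma>"
    have t: "\<theta> i = \<sigma> * t" and Xi: "X i = \<sigma> * (t + x)"
      using assms(4) X[OF i] by (simp_all add: t_def x_def algebra_simps)
    have a: "a i = h / 2 * ((if i \<in> J then 0 else (t + x)\<^sup>2) - (if i \<in> I then 0 else (t + x)\<^sup>2))
        + s * (if i \<in> I then x\<^sup>2 else t\<^sup>2)"
    proof -
      have "X i * indicator I i - \<theta> i = \<sigma> * (if i \<in> I then x else - t)"
        using Xi t by (simp add: algebra_simps)
      then show ?thesis
        using assms(4) unfolding a_def Xi by (simp add: power_mult_distrib)
    qed
    have b: "b i = \<beta> * (if i \<in> I \<union> J then x\<^sup>2 else 0) + \<beta> * (if i \<in> J then 0 else t\<^sup>2)"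
      using assms(4) unfolding b_def t x_def by (simp add: power_mult_distrib)
    have h: "0 \<le> h" "s \<le> \<beta>" using assms by auto
    \<comment> \<open>Upper and lower bounds for (t + x)^2, used on coordinates in I but not J and
      in J but not I respectively.\<close>
    have "0 \<le> (t - x)\<^sup>2" by simp
    then have "(t + x)\<^sup>2 \<le> 2 * t\<^sup>2 + 2 * x\<^sup>2" by (simp add: power2_eq_square algebra_simps)
    then have u: "h / 2 * (t + x)\<^sup>2 \<le> h / 2 * (2 * t\<^sup>2 + 2 * x\<^sup>2)" using h by (intro mult_left_mono) auto
    have "0 \<le> (t + 2 * x)\<^sup>2" by simp
    then have "t\<^sup>2 / 2 - x\<^sup>2 \<le> (t + x)\<^sup>2" by (simp add: power2_eq_square algebra_simps)
    then have l: "h / 2 * (t\<^sup>2 / 2 - x\<^sup>2) \<le> h / 2 * (t + x)\<^sup>2" using h by (intro mult_left_mono) auto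
    have sx: "s * x\<^sup>2 \<le> \<beta> * x\<^sup>2" and st: "s * t\<^sup>2 \<le> \<beta> * t\<^sup>2" and s4: "4 * s * t\<^sup>2 \<le> h * t\<^sup>2"
      and nn: "0 \<le> s * x\<^sup>2" "0 \<le> s * t\<^sup>2" "0 \<le> h * x\<^sup>2"
      using h assms by (auto intro: mult_right_mono)
    show ?thesis unfolding a b assms(3)[symmetric]
      using u l sx st s4 nn by (cases "i \<in> I"; cases "i \<in> J") (simp_all add: algebra_simps)
  qed
  have "h * ((crit \<kappa> n \<sigma> X J - crit \<kappa> n \<sigma> X I) / (2 * \<sigma>\<^sup>2)) + s / \<sigma>\<^sup>2 * loss n \<theta> X I =
      (\<Sum>i\<in>{1..n}. a i) + h * (\<kappa> + 1 / 2) * (pen n J - pen n I)"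
    using assms(4) unfolding crit_def loss_def D a_def sum.distrib sum_subtractf sum_distrib_left[symmetric]
    by (simp add: field_simps)
  moreover have "(\<Sum>i\<in>{1..n}. a i) \<le> (\<Sum>i\<in>{1..n}. b i)" using ab by (rule sum_mono)
  moreover have "(\<Sum>i\<in>{1..n}. b i) = \<beta> * (\<Sum>i\<in>I \<union> J. (\<xi> i)\<^sup>2) + \<beta> / \<sigma>\<^sup>2 * (\<Sum>i\<in>{1..n} - J. (\<theta> i)\<^sup>2)"
    unfolding D U b_def sum.distrib sum_distrib_left ..
  ultimately show ?thesis by linarith
qed

text \<open>Each summand multiplies the bound on the weight of I by the bound on the exponential
  moment of its conditional posterior. The same majorant serves for the posterior and for the
  estimator.\<close>

definition envelope ::
  "real \<Rightarrow> real \<Rightarrow> real \<Rightarrow> nat \<Rightarrow> real \<Rightarrow> (nat \<Rightarrow> real) \<Rightarrow> nat set \<Rightarrow> (nat \<Rightarrow> real) \<Rightarrow> real"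
where
  "envelope h s \<kappa> n \<sigma> \<theta> J X =
     (\<Sum>I\<in>Pow {1..n}. exp (h * ((crit \<kappa> n \<sigma> X J - crit \<kappa> n \<sigma> X I) / (2 * \<sigma>\<^sup>2))) *
        exp (s / \<sigma>\<^sup>2 * loss n \<theta> X I + real (card I) / 2))"

lemma envelope_measurable [measurable]:
  assumes "J \<subseteq> {1..n}"
  shows "envelope h s \<kappa> n \<sigma> \<theta> J \<in> borel_measurable (Rn n)"
proof -
  have [measurable]: "(\<lambda>X. crit \<kappa> n \<sigma> X I) \<in> borel_measurable (Rn n)" for I
    unfolding crit_def by measurable
  have [measurable]: "(\<lambda>X. loss n \<theta> X I) \<in> borel_measurable (Rn n)" for I
    unfolding loss_def by measurable
  show ?thesis unfolding envelope_def by measurable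
qed

text \<open>By \<open>weighted_exponent_le\<close> the noise enters each summand only through the
  squares over the union of I and J, to which the moment condition applies directly; independence is
  never involved.\<close>

lemma nn_integral_envelope_le:
  assumes "0 \<le> s" "4 * s \<le> h" "s + h = \<beta>" "\<sigma> > 0" "J \<subseteq> {1..n}" "0 < B"
    and hk: "B + 2 \<le> h * (\<kappa> + 1 / 2)"
    and P: "noise_law n P" "exch_exp_moment \<beta> B n P"
  shows "(\<integral>\<^sup>+X. ennreal (envelope h s \<kappa> n \<sigma> \<theta> J X) \<partial>obs_law n \<sigma> \<theta> P) \<le>
    ennreal (1 / (1 - exp (- 1 / 2)) * exp ((\<beta> + B + h * (\<kappa> + 1 / 2)) * (rate_sq n \<sigma> J \<theta> / \<sigma>\<^sup>2)))"
proof -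
  define C where "C = \<beta> + B + h * (\<kappa> + 1 / 2)"
  define R where "R = rate_sq n \<sigma> J \<theta> / \<sigma>\<^sup>2"
  define obs where "obs = (\<lambda>\<xi>. \<lambda>i\<in>{1..n}. \<theta> i + \<sigma> * \<xi> i :: real)"
  \<comment> \<open>The part of the exponent that does not depend on the noise.\<close>
  define c where "c = (\<lambda>I. \<beta> / \<sigma>\<^sup>2 * (\<Sum>i\<in>{1..n} - J. (\<theta> i)\<^sup>2)
    + h * (\<kappa> + 1 / 2) * (pen n J - pen n I) + real (card I) / 2)"
  have setsP [measurable_cong]: "sets P = sets (Rn n)" using P by (simp add: noise_law_def)
  have obs [measurable]: "obs \<in> measurable P (Rn n)" unfolding obs_def by measurable
  have \<beta>: "\<beta> \<ge> 0" using assms by linarith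
  \<comment> \<open>The budget for the penalty of I: B is spent on the moment condition and 1/2 on
    the posterior variances, out of at least B + 2, so 3/2 remains for the sum over I. All terms in
    J and the bias go into \<open>C * R\<close>.\<close>
  have c: "B * real (card (I \<union> J)) + c I \<le> C * R + - (3 / 2) * pen n I" if I: "I \<subseteq> {1..n}" for I
  proof -
    define T where "T = (\<Sum>i\<in>{1..n} - J. (\<theta> i)\<^sup>2) / \<sigma>\<^sup>2"
    have T: "T \<ge> 0" by (simp add: T_def sum_nonneg)
    have R: "R = T + pen n J"
      using assms(4) by (simp add: R_def T_def rate_sq_def pen_def add_divide_distrib)
    note p = card_le_pen[OF I] card_le_pen[OF assms(5)]
    then have p0: "pen n I \<ge> 0" "pen n J \<ge> 0" by (meson of_nat_0_le_iff order_trans)+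
    have "real (card (I \<union> J)) \<le> pen n I + pen n J" using card_Un_le[of I J] p by linarith
    then have "B * real (card (I \<union> J)) \<le> B * (pen n I + pen n J)" using assms by (intro mult_left_mono) auto
    moreover have "(B + 2) * pen n I \<le> h * (\<kappa> + 1 / 2) * pen n I"
      using hk p0 by (intro mult_right_mono)
    moreover have "0 \<le> (B + h * (\<kappa> + 1 / 2)) * T" using hk T assms by (intro mult_nonneg_nonneg) auto
    moreover have "0 \<le> \<beta> * pen n J" using \<beta> p0 by simp
    moreover have "c I = \<beta> * T + h * (\<kappa> + 1 / 2) * pen n J - h * (\<kappa> + 1 / 2) * pen n I + real (card I) / 2"
      by (simp add: c_def T_def right_diff_distrib)
    moreover have "C * R = \<beta> * T + \<beta> * pen n J + B * pen n J
        + h * (\<kappa> + 1 / 2) * pen n J + (B + h * (\<kappa> + 1 / 2)) * T"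
      unfolding C_def R by (simp only: distrib_left distrib_right add_ac)
    moreover have "(B + 2) * pen n I = B * pen n I + 2 * pen n I"
      "B * (pen n I + pen n J) = B * pen n I + B * pen n J" by (simp_all add: algebra_simps)
    ultimately show ?thesis using p by linarith
  qed
  have "(\<integral>\<^sup>+X. ennreal (envelope h s \<kappa> n \<sigma> \<theta> J X) \<partial>obs_law n \<sigma> \<theta> P) =
      (\<integral>\<^sup>+\<xi>. ennreal (envelope h s \<kappa> n \<sigma> \<theta> J (obs \<xi>)) \<partial>P)"
    unfolding obs_law_def obs_def[symmetric] using assms(5) by (intro nn_integral_distr) measurable
  also have "\<dots> \<le> (\<integral>\<^sup>+\<xi>. (\<Sum>I\<in>Pow {1..n}. ennreal (exp (c I)) *
      ennreal (exp (\<beta> * (\<Sum>i\<in>I \<union> J. (\<xi> i)\<^sup>2)))) \<partial>P)"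
  proof (rule nn_integral_mono)
    fix \<xi>
    have "envelope h s \<kappa> n \<sigma> \<theta> J (obs \<xi>) \<le>
        (\<Sum>I\<in>Pow {1..n}. exp (c I) * exp (\<beta> * (\<Sum>i\<in>I \<union> J. (\<xi> i)\<^sup>2)))"
      unfolding envelope_def
    proof (rule sum_mono)
      fix I assume "I \<in> Pow {1..n}"
      then have "h * ((crit \<kappa> n \<sigma> (obs \<xi>) J - crit \<kappa> n \<sigma> (obs \<xi>) I) / (2 * \<sigma>\<^sup>2)) +
          (s / \<sigma>\<^sup>2 * loss n \<theta> (obs \<xi>) I + real (card I) / 2) \<le> c I + \<beta> * (\<Sum>i\<in>I \<union> J. (\<xi> i)\<^sup>2)"
        using weighted_exponent_le[OF assms(1-4) _ assms(5), of I "obs \<xi>" \<theta> \<xi> \<kappa>]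
        by (simp add: c_def obs_def)
      then show "exp (h * ((crit \<kappa> n \<sigma> (obs \<xi>) J - crit \<kappa> n \<sigma> (obs \<xi>) I) / (2 * \<sigma>\<^sup>2))) *
          exp (s / \<sigma>\<^sup>2 * loss n \<theta> (obs \<xi>) I + real (card I) / 2) \<le>
          exp (c I) * exp (\<beta> * (\<Sum>i\<in>I \<union> J. (\<xi> i)\<^sup>2))"
        unfolding exp_add[symmetric] by simp
    qed
    then show "ennreal (envelope h s \<kappa> n \<sigma> \<theta> J (obs \<xi>)) \<le>
        (\<Sum>I\<in>Pow {1..n}. ennreal (exp (c I)) * ennreal (exp (\<beta> * (\<Sum>i\<in>I \<union> J. (\<xi> i)\<^sup>2))))"
      by (simp add: ennreal_leI flip: ennreal_mult')
  qed
  also have "\<dots> = (\<Sum>I\<in>Pow {1..n}. ennreal (exp (c I)) *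
      (\<integral>\<^sup>+\<xi>. ennreal (exp (\<beta> * (\<Sum>i\<in>I \<union> J. (\<xi> i)\<^sup>2))) \<partial>P))"
  proof -
    have [measurable]: "(\<lambda>\<xi>. \<Sum>i\<in>I \<union> J. (\<xi> i)\<^sup>2) \<in> borel_measurable P" if "I \<in> Pow {1..n}" for I
    proof (rule borel_measurable_sum)
      fix i assume "i \<in> I \<union> J"
      then have [measurable]: "i \<in> {1..n}" using that assms(5) by auto
      show "(\<lambda>\<xi>. (\<xi> i)\<^sup>2) \<in> borel_measurable P" by measurable
    qed
    show ?thesis by (subst nn_integral_sum) (auto intro!: sum.cong nn_integral_cmult)
  qed
  also have "\<dots> \<le> (\<Sum>I\<in>Pow {1..n}. ennreal (exp (C * R) * exp (- (3 / 2) * pen n I)))"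
  proof (rule sum_mono)
    fix I assume I: "I \<in> Pow {1..n}"
    then have "(\<integral>\<^sup>+\<xi>. ennreal (exp (\<beta> * (\<Sum>i\<in>I \<union> J. (\<xi> i)\<^sup>2))) \<partial>P) \<le> ennreal (exp (B * real (card (I \<union> J))))"
      using P(2) assms(5) by (auto simp: exch_exp_moment_def)
    then have "ennreal (exp (c I)) * (\<integral>\<^sup>+\<xi>. ennreal (exp (\<beta> * (\<Sum>i\<in>I \<union> J. (\<xi> i)\<^sup>2))) \<partial>P) \<le>
        ennreal (exp (c I)) * ennreal (exp (B * real (card (I \<union> J))))"
      by (rule mult_left_mono) simp
    also have "\<dots> = ennreal (exp (B * real (card (I \<union> J)) + c I))"
      by (simp add: exp_add mult.commute flip: ennreal_mult')
    also have "\<dots> \<le> ennreal (exp (C * R + - (3 / 2) * pen n I))"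
      using c I by (intro ennreal_leI) auto
    finally show "ennreal (exp (c I)) * (\<integral>\<^sup>+\<xi>. ennreal (exp (\<beta> * (\<Sum>i\<in>I \<union> J. (\<xi> i)\<^sup>2))) \<partial>P) \<le>
        ennreal (exp (C * R) * exp (- (3 / 2) * pen n I))" by (simp only: exp_add)
  qed
  also have "\<dots> = ennreal (exp (C * R) * (\<Sum>I\<in>Pow {1..n}. exp (- (3 / 2) * pen n I)))"
    by (simp add: sum_distrib_left)
  also have "\<dots> \<le> ennreal (exp (C * R) * (1 / (1 - exp (- 1 / 2))))"
    using sum_Pow_exp_pen_le by (intro ennreal_leI mult_left_mono) auto
  finally show ?thesis unfolding C_def R_def by (simp only: mult.commute)
qed

section \<open>From the envelope to posterior mass and estimation error\<close>

lemma L2_set_power2: "(L2_set f A)\<^sup>2 = (\<Sum>i\<in>A. (f i)\<^sup>2)"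
  by (simp add: L2_set_def sum_nonneg)

text \<open>The exponential Markov inequality is applied under each conditional posterior
  separately; mixing with the bounded weights then reproduces the envelope.\<close>

lemma emeasure_post_le_envelope:
  assumes "eb_procedure \<kappa> n \<sigma> post est" "X \<in> space (Rn n)" "J \<subseteq> {1..n}" "\<sigma> > 0" "0 \<le> h" "h \<le> 1"
    and "0 \<le> s" "s \<le> 1 / 5"
  shows "emeasure (post X) {\<upsilon> \<in> space (Rn n). (L2_set (\<lambda>i. \<upsilon> i - \<theta> i) {1..n})\<^sup>2 \<ge> T}
    \<le> ennreal (exp (- (s / (2 * \<sigma>\<^sup>2) * T)) * envelope h s \<kappa> n \<sigma> \<theta> J X)"
proof -
  define q where "q = s / (2 * \<sigma>\<^sup>2)"
  define f where "f = (\<lambda>\<upsilon>. ennreal (exp (q * (\<Sum>i\<in>{1..n}. (\<upsilon> i - \<theta> i :: real)\<^sup>2))))"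
  define A where "A = {\<upsilon> \<in> space (Rn n). (L2_set (\<lambda>i. \<upsilon> i - \<theta> i) {1..n})\<^sup>2 \<ge> T}"
  have q: "q \<ge> 0" using assms by (simp add: q_def)
  have A: "A \<in> sets (Rn n)" unfolding A_def L2_set_power2 by measurable
  have f: "f \<in> borel_measurable (Rn n)" unfolding f_def by measurable
  obtain w where w: "\<And>I. I \<subseteq> {1..n} \<Longrightarrow> 0 \<le> w I"
    "\<And>I. I \<subseteq> {1..n} \<Longrightarrow> w I \<le> exp (h * ((crit \<kappa> n \<sigma> X J - crit \<kappa> n \<sigma> X I) / (2 * \<sigma>\<^sup>2)))"
    "(\<Sum>I\<in>Pow {1..n}. w I) = 1"
    "\<And>A. A \<in> sets (Rn n) \<Longrightarrow>
       emeasure (post X) A = (\<Sum>I\<in>Pow {1..n}. ennreal (w I) * emeasure (cond_post n \<sigma> X I) A)"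
    "\<And>i. i \<in> {1..n} \<Longrightarrow> est X i = (\<Sum>I\<in>Pow {1..n}. w I * (X i * indicator I i))"
    using eb_procedure_mixture[OF assms(1-6)] by blast
  have cond: "emeasure (cond_post n \<sigma> X I) A \<le>
      ennreal (exp (- (q * T)) * exp (s / \<sigma>\<^sup>2 * loss n \<theta> X I + real (card I) / 2))" if I: "I \<subseteq> {1..n}" for I
  proof -
    have sp: "space (cond_post n \<sigma> X I) = space (Rn n)" by (rule sets_eq_imp_space_eq) simp
    have fm: "f \<in> borel_measurable (cond_post n \<sigma> X I)"
      using f by (simp add: measurable_cong_sets[OF sets_cond_post refl])
    have "A \<subseteq> {\<upsilon> \<in> space (cond_post n \<sigma> X I). 1 \<le> ennreal (exp (- (q * T))) * f \<upsilon>}"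
      using q by (auto simp: A_def sp f_def L2_set_power2 mult_left_mono simp flip: ennreal_mult' exp_add)
    then have "emeasure (cond_post n \<sigma> X I) A \<le>
        emeasure (cond_post n \<sigma> X I) {\<upsilon> \<in> space (cond_post n \<sigma> X I). 1 \<le> ennreal (exp (- (q * T))) * f \<upsilon>}"
      using fm by (intro emeasure_mono) measurable
    also have "\<dots> \<le> ennreal (exp (- (q * T))) *
        (\<integral>\<^sup>+\<upsilon>. f \<upsilon> * indicator (space (cond_post n \<sigma> X I)) \<upsilon> \<partial>cond_post n \<sigma> X I)"
      using fm by (intro nn_integral_Markov_inequality borel_measurable_times_ennreal) (auto simp del: sets_cond_post)
    also have "(\<integral>\<^sup>+\<upsilon>. f \<upsilon> * indicator (space (cond_post n \<sigma> X I)) \<upsilon> \<partial>cond_post n \<sigma> X I) =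
        (\<integral>\<^sup>+\<upsilon>. f \<upsilon> \<partial>cond_post n \<sigma> X I)"
      by (rule nn_integral_cong) simp
    also have "\<dots> \<le> ennreal (exp (s / \<sigma>\<^sup>2 * loss n \<theta> X I + real (card I) / 2))"
      unfolding f_def q_def by (rule nn_integral_exp_cond_post[OF I assms(4,7,8)])
    finally show ?thesis by (simp add: ennreal_mult' mult_left_mono)
  qed
  have "emeasure (post X) A = (\<Sum>I\<in>Pow {1..n}. ennreal (w I) * emeasure (cond_post n \<sigma> X I) A)"
    by (rule w(4)[OF A])
  also have "\<dots> \<le> (\<Sum>I\<in>Pow {1..n}. ennreal (exp (h * ((crit \<kappa> n \<sigma> X J - crit \<kappa> n \<sigma> X I) / (2 * \<sigma>\<^sup>2)))) *
      ennreal (exp (- (q * T)) * exp (s / \<sigma>\<^sup>2 * loss n \<theta> X I + real (card I) / 2)))"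
    using w(1,2) cond by (intro sum_mono mult_mono) (auto intro: ennreal_leI)
  also have "\<dots> = ennreal (exp (- (q * T)) * envelope h s \<kappa> n \<sigma> \<theta> J X)"
    by (simp add: envelope_def sum_distrib_left mult_ac flip: ennreal_mult')
  finally show ?thesis by (simp only: A_def q_def)
qed

text \<open>The estimator is a convex combination of the X(I). Jensen's inequality is used twice:
  for the square in each coordinate, then for the exponential of the averaged loss.\<close>

lemma exp_est_loss_le_envelope:
  assumes "eb_procedure \<kappa> n \<sigma> post est" "X \<in> space (Rn n)" "J \<subseteq> {1..n}" "\<sigma> > 0" "0 \<le> h" "h \<le> 1"
    and "0 \<le> s"
  shows "exp (s / \<sigma>\<^sup>2 * (L2_set (\<lambda>i. est X i - \<theta> i) {1..n})\<^sup>2) \<le> envelope h s \<kappa> n \<sigma> \<theta> J X"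
proof -
  obtain w where w: "\<And>I. I \<subseteq> {1..n} \<Longrightarrow> 0 \<le> w I"
    "\<And>I. I \<subseteq> {1..n} \<Longrightarrow> w I \<le> exp (h * ((crit \<kappa> n \<sigma> X J - crit \<kappa> n \<sigma> X I) / (2 * \<sigma>\<^sup>2)))"
    "(\<Sum>I\<in>Pow {1..n}. w I) = 1"
    "\<And>A. A \<in> sets (Rn n) \<Longrightarrow>
       emeasure (post X) A = (\<Sum>I\<in>Pow {1..n}. ennreal (w I) * emeasure (cond_post n \<sigma> X I) A)"
    "\<And>i. i \<in> {1..n} \<Longrightarrow> est X i = (\<Sum>I\<in>Pow {1..n}. w I * (X i * indicator I i))"
    using eb_procedure_mixture[OF assms(1-6)] by blast
  have jensen: "f (\<Sum>I\<in>Pow {1..n}. w I * y I) \<le> (\<Sum>I\<in>Pow {1..n}. w I * f (y I))"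
    if "convex_on UNIV f" for f y :: "_ \<Rightarrow> real"
    using convex_on_sum[OF _ _ that w(3), of y] w(1) by auto
  have "(\<Sum>i\<in>{1..n}. (est X i - \<theta> i)\<^sup>2) \<le> (\<Sum>i\<in>{1..n}. \<Sum>I\<in>Pow {1..n}. w I * (X i * indicator I i - \<theta> i)\<^sup>2)"
  proof (rule sum_mono)
    fix i assume i: "i \<in> {1..n}"
    have "est X i - \<theta> i = (\<Sum>I\<in>Pow {1..n}. w I * (X i * indicator I i - \<theta> i))"
      using w(3) by (simp add: w(5)[OF i] right_diff_distrib sum_subtractf flip: sum_distrib_right)
    then show "(est X i - \<theta> i)\<^sup>2 \<le> (\<Sum>I\<in>Pow {1..n}. w I * (X i * indicator I i - \<theta> i)\<^sup>2)"
      using jensen[OF convex_power2, of "\<lambda>I. X i * indicator I i - \<theta> i"] w(1) by auto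
  qed
  also have "\<dots> = (\<Sum>I\<in>Pow {1..n}. w I * loss n \<theta> X I)"
    unfolding loss_def sum_distrib_left by (rule sum.swap)
  finally have "s / \<sigma>\<^sup>2 * (L2_set (\<lambda>i. est X i - \<theta> i) {1..n})\<^sup>2 \<le>
      s / \<sigma>\<^sup>2 * (\<Sum>I\<in>Pow {1..n}. w I * loss n \<theta> X I)"
    using assms unfolding L2_set_power2 by (intro mult_left_mono) auto
  then have "exp (s / \<sigma>\<^sup>2 * (L2_set (\<lambda>i. est X i - \<theta> i) {1..n})\<^sup>2) \<le>
      exp (\<Sum>I\<in>Pow {1..n}. w I * (s / \<sigma>\<^sup>2 * loss n \<theta> X I))"
    by (simp add: sum_distrib_left mult_ac)
  also have "\<dots> \<le> (\<Sum>I\<in>Pow {1..n}. w I * exp (s / \<sigma>\<^sup>2 * loss n \<theta> X I))"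
    using jensen[OF exp_convex, of "\<lambda>I. s / \<sigma>\<^sup>2 * loss n \<theta> X I"] w(1) by auto
  \<comment> \<open>The envelope also carries the factors exp (|I| / 2), which are at least
    1.\<close>
  also have "\<dots> \<le> envelope h s \<kappa> n \<sigma> \<theta> J X"
    unfolding envelope_def using w(1,2) by (intro sum_mono mult_mono) auto
  finally show ?thesis .
qed

section \<open>The oracle set and the choice of constants\<close>

lemma oracle_rate_attained:
  obtains J where "J \<subseteq> {1..n}" "oracle_rate_sq n \<sigma> \<theta> = rate_sq n \<sigma> J \<theta>"
proof -
  have "oracle_rate_sq n \<sigma> \<theta> \<in> (\<lambda>I. rate_sq n \<sigma> I \<theta>) ` Pow {1..n}"
    unfolding oracle_rate_sq_def by (intro Min_in) auto
  then show ?thesis using that by auto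
qed

theorem theorem1:
  fixes \<beta> B \<kappa> :: real
  assumes "0 < \<beta>" "\<beta> \<le> 1" "0 < B" "1 < \<kappa>"
    and "\<kappa> > (12 - \<beta> + 4 * B) / (4 * \<beta>)"
  shows "\<exists>M0 M1 H0 H1 m0 m1 :: real.
    M0 > 0 \<and> M1 > 0 \<and> H0 > 0 \<and> H1 > 0 \<and> m0 > 0 \<and> m1 > 0 \<and>
    (\<forall>(n::nat) (\<sigma>::real) (\<theta>::nat \<Rightarrow> real) (P::(nat \<Rightarrow> real) measure) post est (M::real).
       n \<ge> 1 \<longrightarrow> \<sigma> > 0 \<longrightarrow> \<theta> \<in> space (Rn n) \<longrightarrow>
       noise_law n P \<longrightarrow> exch_exp_moment \<beta> B n P \<longrightarrow>
       eb_procedure \<kappa> n \<sigma> post est \<longrightarrow> M \<ge> 0 \<longrightarrow>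
         (\<integral>\<^sup>+ X. emeasure (post X)
                {\<upsilon> \<in> space (Rn n). (L2_set (\<lambda>i. \<upsilon> i - \<theta> i) {1..n})\<^sup>2 \<ge> M0 * oracle_rate_sq n \<sigma> \<theta> + M * \<sigma>\<^sup>2}
             \<partial>obs_law n \<sigma> \<theta> P)
           \<le> ennreal (H0 * exp (- m0 * M)) \<and>
         measure (obs_law n \<sigma> \<theta> P)
           {X \<in> space (Rn n). (L2_set (\<lambda>i. est X i - \<theta> i) {1..n})\<^sup>2 \<ge> M1 * oracle_rate_sq n \<sigma> \<theta> + M * \<sigma>\<^sup>2}
           \<le> H1 * exp (- m1 * M))"
proof -
  \<comment> \<open>These satisfy \<open>s + h = \<beta>\<close> and \<open>4 s \<le> h\<close>, and \<open>h (\<kappa> + 1/2) \<ge> B + 2\<close> follows from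
    \<open>\<beta> (\<kappa> + 1/2) \<ge> B + 3\<close> as \<open>(B + 3) (B + 4) \<ge> (B + 2) (B + 5)\<close>.\<close>
  define s where "s = \<beta> / (5 + B)"
  define h where "h = \<beta> * (4 + B) / (5 + B)"
  define C where "C = \<beta> + B + h * (\<kappa> + 1 / 2)"
  define H :: real where "H = 1 / (1 - exp (- 1 / 2))"
  have s: "0 < s" "s \<le> 1 / 5" using assms by (auto simp: s_def field_simps)
  have "s + h = \<beta> * (5 + B) / (5 + B)"
    by (simp add: s_def h_def algebra_simps flip: add_divide_distrib)
  then have sh: "4 * s \<le> h" "s + h = \<beta>"
    using assms by (simp_all add: s_def h_def divide_right_mono mult.commute)
  then have h: "0 \<le> h" "h \<le> 1" using s assms by auto
  \<comment> \<open>The assumed lower bound on \<kappa> is equivalent to \<beta> (\<kappa> + 1/4) >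
    B + 3.\<close>
  have "3 + B \<le> \<beta> * (\<kappa> + 1 / 2)" using assms by (simp add: field_simps)
  then have "(3 + B) * (4 + B) \<le> \<beta> * (\<kappa> + 1 / 2) * (4 + B)" using assms by (intro mult_right_mono) auto
  then have hk: "B + 2 \<le> h * (\<kappa> + 1 / 2)" using assms by (simp add: h_def field_simps)
  have C: "C > 0" using hk assms unfolding C_def by linarith
  have H: "H > 0" by (simp add: H_def)
  show ?thesis
  proof (intro exI conjI allI impI)
    \<comment> \<open>The expected envelope is at most H exp (C R), with R the oracle rate in units
      of the noise variance. Markov's inequality has rate s / 2 for the posterior and s for the
      estimator, so thresholds 2 C R / s and C R / s are what cancels exp (C R); the same rates
      become the decay constants.\<close>
    show "2 * C / s > 0" "C / s > 0" "H > 0" "H > 0" "s / 2 > 0" "s > 0" using C H s by auto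
    fix n :: nat and \<sigma> :: real and \<theta> :: "nat \<Rightarrow> real" and P :: "(nat \<Rightarrow> real) measure" and post est and M :: real
    assume \<sigma>: "\<sigma> > 0" and P: "noise_law n P" "exch_exp_moment \<beta> B n P"
      and eb: "eb_procedure \<kappa> n \<sigma> post est"
    obtain J where J: "J \<subseteq> {1..n}" and r: "oracle_rate_sq n \<sigma> \<theta> = rate_sq n \<sigma> J \<theta>"
      by (rule oracle_rate_attained)
    define R where "R = rate_sq n \<sigma> J \<theta> / \<sigma>\<^sup>2"
    define G where "G = envelope h s \<kappa> n \<sigma> \<theta> J"
    have sp: "space (obs_law n \<sigma> \<theta> P) = space (Rn n)"
      and st [measurable_cong]: "sets (obs_law n \<sigma> \<theta> P) = sets (Rn n)"
      by (simp_all add: obs_law_def)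
    have [measurable]: "G \<in> borel_measurable (Rn n)" unfolding G_def using J by (rule envelope_measurable)
    have int: "(\<integral>\<^sup>+X. ennreal (a * G X) \<partial>obs_law n \<sigma> \<theta> P) \<le> ennreal (a * (H * exp (C * R)))"
      if "a \<ge> 0" for a
    proof -
      have "(\<integral>\<^sup>+X. ennreal (a * G X) \<partial>obs_law n \<sigma> \<theta> P) = ennreal a * (\<integral>\<^sup>+X. ennreal (G X) \<partial>obs_law n \<sigma> \<theta> P)"
        using that by (simp add: ennreal_mult' nn_integral_cmult)
      also have "\<dots> \<le> ennreal a * ennreal (H * exp (C * R))"
        unfolding G_def H_def C_def R_def
        using nn_integral_envelope_le[OF less_imp_le[OF s(1)] sh \<sigma> J assms(3) hk P]
        by (rule mult_left_mono) simp
      finally show ?thesis using that by (simp add: ennreal_mult')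
    qed
    define T where "T = 2 * C / s * oracle_rate_sq n \<sigma> \<theta> + M * \<sigma>\<^sup>2"
    have "(\<integral>\<^sup>+ X. emeasure (post X) {\<upsilon> \<in> space (Rn n). (L2_set (\<lambda>i. \<upsilon> i - \<theta> i) {1..n})\<^sup>2 \<ge> T}
        \<partial>obs_law n \<sigma> \<theta> P) \<le> (\<integral>\<^sup>+X. ennreal (exp (- (s / (2 * \<sigma>\<^sup>2) * T)) * G X) \<partial>obs_law n \<sigma> \<theta> P)"
      unfolding G_def using s
      by (intro nn_integral_mono emeasure_post_le_envelope[OF eb _ J \<sigma> h]) (auto simp: sp)
    also have "\<dots> \<le> ennreal (exp (- (s / (2 * \<sigma>\<^sup>2) * T)) * (H * exp (C * R)))"
      by (rule int) simp
    also have "s / (2 * \<sigma>\<^sup>2) * T = C * R + s / 2 * M"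
      using \<sigma> s by (simp add: T_def r R_def field_simps)
    also have "exp (- (C * R + s / 2 * M)) * (H * exp (C * R)) = H * exp (- (s / 2) * M)"
      by (simp add: mult.left_commute flip: exp_add)
    finally show "(\<integral>\<^sup>+ X. emeasure (post X) {\<upsilon> \<in> space (Rn n).
          (L2_set (\<lambda>i. \<upsilon> i - \<theta> i) {1..n})\<^sup>2 \<ge> 2 * C / s * oracle_rate_sq n \<sigma> \<theta> + M * \<sigma>\<^sup>2}
        \<partial>obs_law n \<sigma> \<theta> P) \<le> ennreal (H * exp (- (s / 2) * M))"
      by (simp only: T_def)
    define U where "U = C / s * oracle_rate_sq n \<sigma> \<theta> + M * \<sigma>\<^sup>2"
    define a where "a = exp (- (s / \<sigma>\<^sup>2 * U))"
    let ?S = "{X \<in> space (Rn n). (L2_set (\<lambda>i. est X i - \<theta> i) {1..n})\<^sup>2 \<ge> U}"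
    \<comment> \<open>A superlevel set of the measurable \<open>G\<close>: the monotonicity of
      \<open>emeasure\<close> asks for measurability of the larger set, and Markov's inequality
      applies to it.\<close>
    let ?S' = "{X \<in> space (obs_law n \<sigma> \<theta> P). 1 \<le> 1 * ennreal (a * G X)}"
    have "?S \<subseteq> ?S'"
    proof
      fix X assume X: "X \<in> ?S"
      then have "s / \<sigma>\<^sup>2 * U \<le> s / \<sigma>\<^sup>2 * (L2_set (\<lambda>i. est X i - \<theta> i) {1..n})\<^sup>2"
        using s by (intro mult_left_mono) auto
      then have "exp (s / \<sigma>\<^sup>2 * U) \<le> exp (s / \<sigma>\<^sup>2 * (L2_set (\<lambda>i. est X i - \<theta> i) {1..n})\<^sup>2)" by simp
      also have "\<dots> \<le> G X"
        unfolding G_def using X s by (intro exp_est_loss_le_envelope[OF eb _ J \<sigma> h]) auto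
      finally have "1 \<le> a * G X" by (simp add: a_def exp_minus field_simps)
      then show "X \<in> ?S'" using X by (simp add: sp)
    qed
    then have "emeasure (obs_law n \<sigma> \<theta> P) ?S \<le> emeasure (obs_law n \<sigma> \<theta> P) ?S'"
      by (rule emeasure_mono) measurable
    also have "\<dots> \<le> 1 * (\<integral>\<^sup>+X. ennreal (a * G X) * indicator (space (obs_law n \<sigma> \<theta> P)) X \<partial>obs_law n \<sigma> \<theta> P)"
      by (intro nn_integral_Markov_inequality) measurable
    also have "\<dots> = (\<integral>\<^sup>+X. ennreal (a * G X) \<partial>obs_law n \<sigma> \<theta> P)"
      by (simp cong: nn_integral_cong)
    also have "\<dots> \<le> ennreal (a * (H * exp (C * R)))" by (rule int) (simp add: a_def)
    also have "s / \<sigma>\<^sup>2 * U = C * R + s * M" using \<sigma> s by (simp add: U_def r R_def field_simps)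
    then have "a * (H * exp (C * R)) = H * exp (- s * M)"
      unfolding a_def by (simp add: mult.left_commute flip: exp_add)
    finally have "measure (obs_law n \<sigma> \<theta> P) ?S \<le> H * exp (- s * M)"
      unfolding measure_def using H by (intro enn2real_leI) auto
    then show "measure (obs_law n \<sigma> \<theta> P) {X \<in> space (Rn n).
        (L2_set (\<lambda>i. est X i - \<theta> i) {1..n})\<^sup>2 \<ge> C / s * oracle_rate_sq n \<sigma> \<theta> + M * \<sigma>\<^sup>2}
        \<le> H * exp (- s * M)"
      by (simp only: U_def)
  qed
qed

end
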